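(* For $\ell>0$ let $\Omega_\ell=(0,\pi)\times(-\ell,\ell)$ and let $\lambda_1(\Omega_\ell)$ be the smallest eigenvalue of the problem \[ \begin{cases} \Delta^2 u=-\lambda \Delta u, & \text{in }\Omega_\ell,\\ u=0, & \text{on }\partial\Omega_\ell,\\ u_y=0, & \text{on }(0,\pi)\times\{-\ell,\ell\},\\ u_{xx}=0, & \text{on }\{0,\pi\}\times(-\ell,\ell). \end{cases} \] Then there exists a sequence $\ell_k\to0$ such that, for each $k$, there exists an eigenfunction associated with $\lambda_1(\Omega_{\ell_k})$ having exactly $k$ nodal domains.
   Context: A nodal domain of a function $u$ on $\Omega_\ell$ is a connected component of $\{(x,y)\in\Omega_\ell: u(x,y)\neq0\}$. *)

theory Defs
  imports "HOL-Analysis.Analysis"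
begin

definition Dx :: "(real \<times> real \<Rightarrow> real) \<Rightarrow> real \<times> real \<Rightarrow> real" where
  "Dx u = (\<lambda>(x, y). deriv (\<lambda>t. u (t, y)) x)"

definition Dy :: "(real \<times> real \<Rightarrow> real) \<Rightarrow> real \<times> real \<Rightarrow> real" where
  "Dy u = (\<lambda>(x, y). deriv (\<lambda>t. u (x, t)) y)"

fun Ck :: "nat \<Rightarrow> (real \<times> real) set \<Rightarrow> (real \<times> real \<Rightarrow> real) \<Rightarrow> bool" where
  "Ck 0 U u = continuous_on U u"
| "Ck (Suc k) U u =
     (continuous_on U u \<and>
      (\<forall>(x, y)\<in>U. (\<lambda>t. u (t, y)) differentiable (at x) \<and> (\<lambda>t. u (x, t)) differentiable (at y)) \<and>
      Ck k U (Dx u) \<and> Ck k U (Dy u))"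

definition Lap :: "(real \<times> real \<Rightarrow> real) \<Rightarrow> real \<times> real \<Rightarrow> real" where
  "Lap u = (\<lambda>p. Dx (Dx u) p + Dy (Dy u) p)"

definition Omega :: "real \<Rightarrow> (real \<times> real) set" where
  "Omega l = {0<..<pi} \<times> {-l<..<l}"

definition Omega_cl :: "real \<Rightarrow> (real \<times> real) set" where
  "Omega_cl l = {0..pi} \<times> {-l..l}"

text \<open>Classical eigenpair: u is C^4 up to the boundary (i.e. restriction of a C^4 function
  on an open neighbourhood of the closed rectangle), nontrivial in Omega_l, and satisfies
  the PDE and the boundary conditions pointwise.\<close>
definition eigenpair :: "real \<Rightarrow> real \<Rightarrow> (real \<times> real \<Rightarrow> real) \<Rightarrow> bool" where
  "eigenpair l lam u \<longleftrightarrow>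
     (\<exists>U. open U \<and> Omega_cl l \<subseteq> U \<and> Ck 4 U u) \<and>
     (\<exists>p\<in>Omega l. u p \<noteq> 0) \<and>
     (\<forall>p\<in>Omega l. Lap (Lap u) p = - lam * Lap u p) \<and>
     (\<forall>p\<in>Omega_cl l - Omega l. u p = 0) \<and>
     (\<forall>x\<in>{0<..<pi}. Dy u (x, -l) = 0 \<and> Dy u (x, l) = 0) \<and>
     (\<forall>y\<in>{-l<..<l}. Dx (Dx u) (0, y) = 0 \<and> Dx (Dx u) (pi, y) = 0)"

definition lambda1 :: "real \<Rightarrow> real" where
  "lambda1 l = Inf {lam. \<exists>u. eigenpair l lam u}"

definition nodal_domains :: "real \<Rightarrow> (real \<times> real \<Rightarrow> real) \<Rightarrow> (real \<times> real) set set" where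
  "nodal_domains l u = components {p \<in> Omega l. u p \<noteq> 0}"

end

theory Submission
  imports Defs
begin

text \<open>The sine coefficients in \<open>x\<close> of an eigenfunction solve a clamped fourth-order problem in \<open>y\<close>,
  whose solvability forces \<open>\<lambda> l\<^sup>2 = s\<^sup>2 + t\<^sup>2\<close> with \<open>s = m l\<close> and \<open>t tan t = - s tanh s\<close> (even modes) or
  \<open>s tan t = t tanh s\<close> (odd modes). Over all real \<open>s > 0\<close>, the sum \<open>s\<^sup>2 + t\<^sup>2\<close> attains its minimum at an
  even mode \<open>(s*, t*)\<close> with \<open>s* > 0\<close> and \<open>\<pi>/2 < t* < \<pi>\<close>. For \<open>l = s*/k\<close> this minimum is reached at the
  integer frequency \<open>m = k\<close>, so \<open>sin (k x) \<phi>(y)\<close> is a first eigenfunction; its profile \<open>\<phi>\<close> does not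
  vanish inside the interval, hence the nodal domains are the \<open>k\<close> rectangles cut out by \<open>sin (k x)\<close>.\<close>

subsection \<open>Partial derivatives and sine coefficients\<close>

lemma Ck_imp_continuous_on: "Ck k U u \<Longrightarrow> continuous_on U u"
  by (cases k) auto

lemma eventually_section_x:
  assumes "open U" "(x, y) \<in> U"
  shows "\<forall>\<^sub>F t in nhds x. (t, y) \<in> (U :: (real \<times> real) set)"
proof -
  have "open ((\<lambda>t. (t, y)) -` U)"
    by (rule open_vimage[OF assms(1)]) (intro continuous_intros)
  then show ?thesis
    using assms(2) by (auto simp: eventually_nhds)
qed

lemma eventually_section_y:
  assumes "open U" "(x, y) \<in> U"
  shows "\<forall>\<^sub>F t in nhds y. (x, t) \<in> (U :: (real \<times> real) set)"
proof -
  have "open ((\<lambda>t. (x, t)) -` U)"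
    by (rule open_vimage[OF assms(1)]) (intro continuous_intros)
  then show ?thesis
    using assms(2) by (auto simp: eventually_nhds)
qed

lemma Dx_cong_open:
  assumes "open U" "\<And>q. q \<in> U \<Longrightarrow> f q = g q" "p \<in> U"
  shows "Dx f p = Dx g p"
  unfolding Dx_def using assms
  by (cases p) (auto intro!: deriv_cong_ev eventually_mono[OF eventually_section_x[OF assms(1)]])

lemma Dy_cong_open:
  assumes "open U" "\<And>q. q \<in> U \<Longrightarrow> f q = g q" "p \<in> U"
  shows "Dy f p = Dy g p"
  unfolding Dy_def using assms
  by (cases p) (auto intro!: deriv_cong_ev eventually_mono[OF eventually_section_y[OF assms(1)]])

text \<open>\<open>Dx\<close> and \<open>Dy\<close> are built on the total operator
  \<open>deriv\<close>, so derivative rules give equalities on U only. Openness of U makes agreement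
  there pass to the sections near each point, hence to all partial derivatives by induction.\<close>

lemma Ck_cong_open:
  assumes "open U"
  shows "(\<And>q. q \<in> U \<Longrightarrow> f q = g q) \<Longrightarrow> Ck k U f \<Longrightarrow> Ck k U g"
proof (induction k arbitrary: f g)
  case 0
  then show ?case by (simp cong: continuous_on_cong)
next
  case (Suc k)
  have "(\<lambda>t. g (t, y)) differentiable at x" "(\<lambda>t. g (x, t)) differentiable at y"
    if "(x, y) \<in> U" for x y
  proof -
    have d: "(\<lambda>t. f (t, y)) differentiable at x" "(\<lambda>t. f (x, t)) differentiable at y"
      using Suc.prems(2) that by auto
    have "\<forall>\<^sub>F t in nhds x. f (t, y) = g (t, y)" "\<forall>\<^sub>F t in nhds y. f (x, t) = g (x, t)"
      using eventually_section_x[OF assms that] eventually_section_y[OF assms that]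
      by (auto elim!: eventually_mono intro: Suc.prems(1))
    with d show "(\<lambda>t. g (t, y)) differentiable at x" "(\<lambda>t. g (x, t)) differentiable at y"
      by (metis DERIV_cong_ev real_differentiable_def)+
  qed
  moreover have "continuous_on U g"
    using Suc.prems by (simp cong: continuous_on_cong)
  moreover have "Ck k U (Dx g)"
    by (rule Suc.IH[of "Dx f"]) (use Suc.prems in \<open>auto intro: Dx_cong_open[OF assms]\<close>)
  moreover have "Ck k U (Dy g)"
    by (rule Suc.IH[of "Dy f"]) (use Suc.prems in \<open>auto intro: Dy_cong_open[OF assms]\<close>)
  ultimately show ?case by auto
qed

lemma differentiable_imp_Dx:
  "(\<lambda>t. u (t, y)) differentiable at x \<Longrightarrow> ((\<lambda>t. u (t, y)) has_real_derivative Dx u (x, y)) (at x)"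
  by (simp add: Dx_def DERIV_deriv_iff_real_differentiable)

lemma differentiable_imp_Dy:
  "(\<lambda>t. u (x, t)) differentiable at y \<Longrightarrow> ((\<lambda>t. u (x, t)) has_real_derivative Dy u (x, y)) (at y)"
  by (simp add: Dy_def DERIV_deriv_iff_real_differentiable)

lemma Ck_Suc_Dx:
  "Ck (Suc k) U u \<Longrightarrow> (x, y) \<in> U \<Longrightarrow> ((\<lambda>t. u (t, y)) has_real_derivative Dx u (x, y)) (at x)"
  by (rule differentiable_imp_Dx) auto

lemma Ck_Suc_Dy:
  "Ck (Suc k) U u \<Longrightarrow> (x, y) \<in> U \<Longrightarrow> ((\<lambda>t. u (x, t)) has_real_derivative Dy u (x, y)) (at y)"
  by (rule differentiable_imp_Dy) auto

lemma Ck_add: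
  assumes "open U"
  shows "Ck k U f \<Longrightarrow> Ck k U g \<Longrightarrow> Ck k U (\<lambda>p. f p + g p)"
proof (induction k arbitrary: f g)
  case 0
  then show ?case by (auto intro: continuous_intros)
next
  case (Suc k)
  have d: "((\<lambda>t. f (t, y) + g (t, y)) has_real_derivative Dx f (x, y) + Dx g (x, y)) (at x)"
    "((\<lambda>t. f (x, t) + g (x, t)) has_real_derivative Dy f (x, y) + Dy g (x, y)) (at y)"
    if "(x, y) \<in> U" for x y
    using Ck_Suc_Dx[OF Suc.prems(1) that] Ck_Suc_Dx[OF Suc.prems(2) that]
      Ck_Suc_Dy[OF Suc.prems(1) that] Ck_Suc_Dy[OF Suc.prems(2) that]
    by (auto intro: DERIV_add)
  then have "Dx f p + Dx g p = Dx (\<lambda>p. f p + g p) p" "Dy f p + Dy g p = Dy (\<lambda>p. f p + g p) p"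
    if "p \<in> U" for p
    using that by (cases p; force simp: Dx_def Dy_def dest: DERIV_imp_deriv)+
  moreover have "Ck k U (\<lambda>p. Dx f p + Dx g p)" "Ck k U (\<lambda>p. Dy f p + Dy g p)"
    using Suc by auto
  ultimately have "Ck k U (Dx (\<lambda>p. f p + g p))" "Ck k U (Dy (\<lambda>p. f p + g p))"
    using Ck_cong_open[OF assms, of "\<lambda>p. Dx f p + Dx g p" "Dx (\<lambda>p. f p + g p)" k]
      Ck_cong_open[OF assms, of "\<lambda>p. Dy f p + Dy g p" "Dy (\<lambda>p. f p + g p)" k] by simp_all
  moreover have "(\<lambda>t. f (t, y) + g (t, y)) differentiable at x"
    "(\<lambda>t. f (x, t) + g (x, t)) differentiable at y" if "(x, y) \<in> U" for x y
    using d[OF that] unfolding real_differentiable_def by blast+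
  ultimately show ?case
    using Suc.prems by (auto intro!: continuous_intros)
qed

lemma Ck_Lap: "open U \<Longrightarrow> Ck (Suc (Suc k)) U u \<Longrightarrow> Ck k U (Lap u)"
  unfolding Lap_def by (rule Ck_add) auto

section \<open>Sine coefficients in x\<close>

lemma continuous_on_section:
  assumes "continuous_on U (v :: real \<times> real \<Rightarrow> real)" "A \<times> B \<subseteq> U" "y \<in> B"
  shows "continuous_on A (\<lambda>x. v (x, y))"
  by (rule continuous_on_compose2[OF assms(1)]) (use assms in \<open>auto intro!: continuous_intros\<close>)

definition sine_coeff :: "nat \<Rightarrow> (real \<times> real \<Rightarrow> real) \<Rightarrow> real \<Rightarrow> real" where
  "sine_coeff m v y = integral {0..pi} (\<lambda>x. v (x, y) * sin (real m * x))"

lemma sine_coeff_integrable: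
  assumes "continuous_on U v" "{0..pi} \<times> J \<subseteq> U" "(y :: real) \<in> J"
  shows "(\<lambda>x. v (x, y) * sin (real m * x)) integrable_on {0..pi}"
  by (intro integrable_continuous_real continuous_intros continuous_on_section[OF assms])

text \<open>Differentiation under the integral sign. The derivative is taken within J so that J may
  be the closed interval, with one-sided derivatives at its ends, or the open one.\<close>

lemma sine_coeff_has_derivative:
  assumes v: "Ck (Suc k) U v" and U: "{0..pi} \<times> J \<subseteq> U" and "convex J" "y \<in> J"
  shows "(sine_coeff m v has_real_derivative sine_coeff m (Dy v) y) (at y within J)"
proof -
  have "((\<lambda>y. integral (cbox 0 pi) (\<lambda>x. v (x, y) * sin (real m * x))) has_real_derivative
      integral (cbox 0 pi) (\<lambda>x. Dy v (x, y) * sin (real m * x))) (at y within J)"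
  proof (rule leibniz_rule_field_derivative)
    fix z x assume "z \<in> J" "x \<in> cbox 0 pi"
    then have "(x, z) \<in> U" using U by auto
    from Ck_Suc_Dy[OF v this]
    show "((\<lambda>z. v (x, z) * sin (real m * x)) has_real_derivative
        Dy v (x, z) * sin (real m * x)) (at z within J)"
      by (intro DERIV_cmult_right) (rule has_field_derivative_at_within)
  next
    fix z assume "z \<in> J"
    then show "(\<lambda>x. v (x, z) * sin (real m * x)) integrable_on cbox 0 pi"
      using sine_coeff_integrable[OF Ck_imp_continuous_on[OF v] U] by simp
  next
    have "continuous_on U (Dy v)"
      using v by (auto intro: Ck_imp_continuous_on)
    then have "continuous_on (J \<times> cbox 0 pi) (\<lambda>p. Dy v (snd p, fst p))"
      by (rule continuous_on_compose2) (use U in \<open>auto intro!: continuous_intros\<close>)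
    then show "continuous_on (J \<times> cbox 0 pi) (\<lambda>(z, x). Dy v (x, z) * sin (real m * x))"
      by (auto simp: case_prod_unfold intro!: continuous_intros)
  qed fact+
  then show ?thesis
    by (simp add: sine_coeff_def[abs_def])
qed

text \<open>Two integrations by parts: the boundary terms vanish because v is 0 on both sides and
  sin (m x) is 0 at 0 and pi for integer m.\<close>

lemma sine_coeff_Dx_Dx:
  assumes v: "Ck (Suc (Suc k)) U v" and U: "{0..pi} \<times> J \<subseteq> U" and y: "y \<in> J"
    and bc: "v (0, y) = 0" "v (pi, y) = 0"
  shows "sine_coeff m (Dx (Dx v)) y = - (real m)\<^sup>2 * sine_coeff m v y"
proof -
  define F where "F = (\<lambda>x. Dx v (x, y) * sin (real m * x) - real m * (v (x, y) * cos (real m * x)))"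
  have v1: "Ck (Suc k) U (Dx v)" using v by simp
  have "((\<lambda>x. Dx (Dx v) (x, y) * sin (real m * x) + (real m)\<^sup>2 * (v (x, y) * sin (real m * x)))
      has_integral F pi - F 0) {0..pi}"
  proof (rule fundamental_theorem_of_calculus)
    fix x assume "x \<in> {0..pi}"
    then have xy: "(x, y) \<in> U" using U y by auto
    have "(F has_real_derivative
        Dx (Dx v) (x, y) * sin (real m * x) + (real m)\<^sup>2 * (v (x, y) * sin (real m * x))) (at x)"
      unfolding F_def
      by (rule derivative_eq_intros Ck_Suc_Dx[OF v xy] Ck_Suc_Dx[OF v1 xy] refl)+
         (simp add: algebra_simps power2_eq_square)
    then show "(F has_vector_derivative
        Dx (Dx v) (x, y) * sin (real m * x) + (real m)\<^sup>2 * (v (x, y) * sin (real m * x)))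
        (at x within {0..pi})"
      by (simp add: has_field_derivative_at_within has_real_derivative_iff_has_vector_derivative[symmetric])
  qed simp
  moreover have "F pi - F 0 = 0"
    by (simp add: F_def bc)
  ultimately have *: "integral {0..pi} (\<lambda>x. Dx (Dx v) (x, y) * sin (real m * x)
      + (real m)\<^sup>2 * (v (x, y) * sin (real m * x))) = 0"
    by (simp add: integral_unique)
  have "continuous_on U (Dx (Dx v))" "continuous_on U v"
    using v by (auto intro: Ck_imp_continuous_on)
  note int = this[THEN sine_coeff_integrable[OF _ U y]]
  from * integral_add[OF int(1) integrable_on_cmult_left[OF int(2), of "(real m)\<^sup>2"]]
  show ?thesis
    by (simp add: sine_coeff_def add_eq_0_iff)
qed

lemma sine_coeff_Lap:
  assumes v: "Ck (Suc (Suc k)) U v" and U: "{0..pi} \<times> J \<subseteq> U" and y: "y \<in> J"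
    and bc: "v (0, y) = 0" "v (pi, y) = 0"
  shows "sine_coeff m (Lap v) y = sine_coeff m (Dy (Dy v)) y - (real m)\<^sup>2 * sine_coeff m v y"
proof -
  have "continuous_on U (Dx (Dx v))" "continuous_on U (Dy (Dy v))"
    using v by (auto intro: Ck_imp_continuous_on)
  note int = this[THEN sine_coeff_integrable[OF _ U y]]
  have "sine_coeff m (Lap v) y = sine_coeff m (Dx (Dx v)) y + sine_coeff m (Dy (Dy v)) y"
    using integral_add[OF int] by (simp add: sine_coeff_def Lap_def algebra_simps)
  with sine_coeff_Dx_Dx[OF assms] show ?thesis by simp
qed

text \<open>Orthogonality to all \<open>sin (m x)\<close> gives orthogonality to \<open>sin x * p (cos x)\<close> for every
  polynomial \<open>p\<close>, and \<open>g\<close> itself is a uniform limit of functions \<open>p (cos x)\<close>.\<close>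

lemma sine_system_complete:
  fixes g :: "real \<Rightarrow> real"
  assumes g: "continuous_on {0..pi} g"
    and zero: "\<And>m :: nat. integral {0..pi} (\<lambda>x. g x * sin (real m * x)) = 0"
    and x: "x \<in> {0<..<pi}"
  shows "g x = 0"
proof -
  have int: "(\<lambda>x. g x * h x) integrable_on {0..pi}" if "continuous_on {0..pi} h" for h
    by (intro integrable_continuous_real continuous_on_mult g that)
  \<comment> \<open>The identity sin (m x) cos x = (sin ((m+1) x) + sin ((m-1) x)) / 2 removes one
    power of cos x at a time. Since m - 1 may drop below 0, m ranges over the integers; oddness of
    sine settles the negative case.\<close>
  have powers: "integral {0..pi} (\<lambda>x. g x * (sin (of_int m * x) * cos x ^ n)) = 0" for m :: int and n
  proof (induction n arbitrary: m)
    case 0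
    show ?case
    proof (cases m rule: int_cases2)
      case (nonneg k)
      then show ?thesis using zero[of k] by simp
    next
      case (nonpos k)
      then show ?thesis using zero[of k] by simp
    qed
  next
    case (Suc n)
    have eq: "g x * (sin (of_int m * x) * cos x ^ Suc n) =
        1 / 2 * (g x * (sin (of_int (m + 1) * x) * cos x ^ n)) +
        1 / 2 * (g x * (sin (of_int (m - 1) * x) * cos x ^ n))" for x
    proof -
      have "sin (of_int m * x) * cos x = (sin (of_int (m + 1) * x) + sin (of_int (m - 1) * x)) / 2"
        by (subst sin_times_cos) (simp add: algebra_simps)
      then have "g x * (sin (of_int m * x) * cos x ^ Suc n) =
          g x * ((sin (of_int (m + 1) * x) + sin (of_int (m - 1) * x)) / 2) * cos x ^ n"
        by (simp add: mult_ac)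
      then show ?thesis by (simp add: algebra_simps add_divide_distrib)
    qed
    have i: "(\<lambda>x. 1 / 2 * (g x * (sin (of_int j * x) * cos x ^ n))) integrable_on {0..pi}" for j
      by (intro integrable_on_mult_right int continuous_intros)
    show ?case
      unfolding eq integral_add[OF i i] integral_mult_right Suc.IH by simp
  qed
  \<comment> \<open>J is the square norm of g with weight sin x, the weight carried by the test
    functions sin x * p (cos x). Subtracting an orthogonal test function leaves J unchanged, so
    approximation within e bounds it by e * K.\<close>
  define J where "J = integral {0..pi} (\<lambda>x. g x * (g x * sin x))"
  define K where "K = integral {0..pi} (\<lambda>x. \<bar>g x\<bar> * sin x)"
  have "K \<ge> 0"
    unfolding K_def by (intro integral_nonneg integrable_continuous_real continuous_intros g)
      (auto simp: sin_ge_zero)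
  have small: "\<bar>J\<bar> \<le> e * K" if "e > 0" for e
  proof -
    have "continuous_on {-1..1} (\<lambda>t. g (arccos t))"
      by (rule continuous_on_compose2[OF g]) (auto intro!: continuous_intros arccos_lbound arccos_ubound)
    then obtain p where p: "real_polynomial_function p"
      and approx: "\<And>t. t \<in> {-1..1} \<Longrightarrow> \<bar>g (arccos t) - p t\<bar> < e"
      using Stone_Weierstrass_real_polynomial_function[of "{-1..1}" _ e] \<open>e > 0\<close> by auto
    obtain c n where c: "p = (\<lambda>t. \<Sum>i\<le>n. c i * t ^ i)"
      using p real_polynomial_function_iff_sum by auto
    have "integral {0..pi} (\<lambda>x. g x * (sin x * p (cos x)))
        = integral {0..pi} (\<lambda>x. \<Sum>i\<le>n. c i * (g x * (sin (of_int 1 * x) * cos x ^ i)))"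
      by (simp add: c sum_distrib_left mult_ac)
    also have "\<dots> = (\<Sum>i\<le>n. integral {0..pi} (\<lambda>x. c i * (g x * (sin (of_int 1 * x) * cos x ^ i))))"
      by (intro integral_sum integrable_on_mult_right int continuous_intros) auto
    also have "\<dots> = 0"
      unfolding integral_mult_right powers by simp
    finally have ortho: "integral {0..pi} (\<lambda>x. g x * (sin x * p (cos x))) = 0" .
    have pc: "continuous_on {0..pi} (\<lambda>x. p (cos x))"
      unfolding c by (intro continuous_intros)
    have "J = integral {0..pi} (\<lambda>x. g x * (g x * sin x) - g x * (sin x * p (cos x)))"
      unfolding J_def
      by (subst integral_diff) (intro int continuous_intros g pc | simp add: ortho)+
    also have "norm \<dots> \<le> integral {0..pi} (\<lambda>x. e * (\<bar>g x\<bar> * sin x))"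
    proof (rule integral_norm_bound_integral)
      show "(\<lambda>x. g x * (g x * sin x) - g x * (sin x * p (cos x))) integrable_on {0..pi}"
        by (intro integrable_diff int continuous_intros g pc)
      show "(\<lambda>x. e * (\<bar>g x\<bar> * sin x)) integrable_on {0..pi}"
        by (intro integrable_continuous_real continuous_intros g)
    next
      fix x assume x: "x \<in> {0..pi}"
      then have "\<bar>g x - p (cos x)\<bar> \<le> e"
        using approx[of "cos x"] by (simp add: arccos_cos)
      moreover have "sin x \<ge> 0" using x by (simp add: sin_ge_zero)
      ultimately have "(\<bar>g x\<bar> * sin x) * \<bar>g x - p (cos x)\<bar> \<le> (\<bar>g x\<bar> * sin x) * e"
        by (intro mult_left_mono) auto
      moreover have "norm (g x * (g x * sin x) - g x * (sin x * p (cos x)))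
          = (\<bar>g x\<bar> * sin x) * \<bar>g x - p (cos x)\<bar>"
      proof -
        have "g x * (g x * sin x) - g x * (sin x * p (cos x)) = (g x * sin x) * (g x - p (cos x))"
          by (simp add: algebra_simps)
        then show ?thesis using \<open>sin x \<ge> 0\<close> by (simp add: abs_mult)
      qed
      ultimately show "norm (g x * (g x * sin x) - g x * (sin x * p (cos x))) \<le> e * (\<bar>g x\<bar> * sin x)"
        by (simp add: mult_ac)
    qed
    finally show ?thesis by (simp add: K_def)
  qed
  have "J = 0"
  proof (rule ccontr)
    assume "J \<noteq> 0"
    \<comment> \<open>The choice e = |J| / (K + 1) makes e * K strictly smaller than |J|; the added
      1 keeps the denominator positive.\<close>
    then have "\<bar>J\<bar> \<le> \<bar>J\<bar> / (K + 1) * K"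
      using \<open>K \<ge> 0\<close> by (intro small) (simp add: divide_pos_pos)
    with \<open>J \<noteq> 0\<close> \<open>K \<ge> 0\<close> show False by (simp add: field_simps)
  qed
  moreover have "0 \<le> g x * (g x * sin x)" if "x \<in> {0..pi}" for x
  proof -
    have "g x * (g x * sin x) = (g x)\<^sup>2 * sin x" by (simp add: power2_eq_square)
    moreover have "(g x)\<^sup>2 * sin x \<ge> 0"
      using that by (intro mult_nonneg_nonneg) (simp_all add: sin_ge_zero)
    ultimately show ?thesis by (simp only:)
  qed
  moreover have "continuous_on {0..pi} (\<lambda>x. g x * (g x * sin x))"
    by (intro continuous_intros g)
  ultimately have "\<forall>x\<in>{0..pi}. g x * (g x * sin x) = 0"
    using integral_eq_0_iff[of 0 pi "\<lambda>x. g x * (g x * sin x)"] unfolding J_def by simp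
  moreover have "x \<in> {0..pi}" "sin x > 0"
    using x by (auto intro: sin_gt_zero)
  ultimately show ?thesis by force
qed

subsection \<open>The clamped ODE in one variable\<close>

text \<open>Here \<open>a\<close> is a sine coefficient of the eigenfunction and \<open>b = a'' - m\<^sup>2 a\<close> that of its Laplacian.
  The clamped conditions on \<open>a\<close> turn into orthogonality of \<open>b\<close> to \<open>cosh (m y)\<close> and \<open>sinh (m y)\<close>.\<close>

lemma buckling_mode_condition:
  fixes m l lam :: real and a a' b b' :: "real \<Rightarrow> real"
  assumes l: "l > 0" and m: "m > 0"
    and a: "\<And>y. y \<in> {-l..l} \<Longrightarrow> (a has_real_derivative a' y) (at y within {-l..l})"
    and a': "\<And>y. y \<in> {-l..l} \<Longrightarrow> (a' has_real_derivative b y + m\<^sup>2 * a y) (at y within {-l..l})"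
    and b: "\<And>y. y \<in> {-l..l} \<Longrightarrow> (b has_real_derivative b' y) (at y within {-l..l})"
    and b': "\<And>y. y \<in> {-l<..<l} \<Longrightarrow> (b' has_real_derivative (m\<^sup>2 - lam) * b y) (at y)"
    and cont: "continuous_on {-l..l} b'"
    and bc: "a (-l) = 0" "a l = 0" "a' (-l) = 0" "a' l = 0"
    and nz: "y0 \<in> {-l..l}" "a y0 \<noteq> 0"
  obtains \<nu> where "\<nu> > 0" "lam = m\<^sup>2 + \<nu>\<^sup>2"
    "m * sinh (m * l) * cos (\<nu> * l) + \<nu> * cosh (m * l) * sin (\<nu> * l) = 0 \<or>
     m * cosh (m * l) * sin (\<nu> * l) - \<nu> * sinh (m * l) * cos (\<nu> * l) = 0"
proof -
  have at: "(a has_real_derivative a' y) (at y)" "(a' has_real_derivative b y + m\<^sup>2 * a y) (at y)"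
    "(b has_real_derivative b' y) (at y)" if "y \<in> {-l<..<l}" for y
    using a[of y] a'[of y] b[of y] that at_within_Icc_at[of "-l" y l] by auto
  have conts [continuous_intros]: "continuous_on {-l..l} a" "continuous_on {-l..l} a'"
      "continuous_on {-l..l} b"
    using DERIV_continuous_on[OF a] DERIV_continuous_on[OF a'] DERIV_continuous_on[OF b] by blast+
  have const: "f y = f l" if "continuous_on {-l..l} f" "y \<in> {-l..l}"
     and d: "\<And>y. y \<in> {-l<..<l} \<Longrightarrow> (f has_real_derivative 0) (at y)" for f y
  proof -
    have "f z = f (-l)" if "z \<in> {-l..l}" for z
      by (rule DERIV_isconst2[of "-l" l]) (use l that d \<open>continuous_on {-l..l} f\<close> in simp_all)
    from this[of y] this[of l] show ?thesis using l that(2) by simp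
  qed
  \<comment> \<open>Pointwise substitute for an energy integral: f is nondecreasing with zero end
    values, hence vanishes, and so does its derivative D.\<close>
  have zero_of_nonneg: "D y = 0" if cf: "continuous_on {-l..l} f" and f0: "f (-l) = 0" "f l = 0"
     and fd: "\<And>y. y \<in> {-l<..<l} \<Longrightarrow> (f has_real_derivative D y) (at y)"
     and D0: "\<And>y. y \<in> {-l<..<l} \<Longrightarrow> D y \<ge> 0"
     and yl: "y \<in> {-l<..<l}" for f D y
  proof -
    have le: "f u \<le> f v" if "-l \<le> u" "u \<le> v" "v \<le> l" for u v
    proof (rule DERIV_nonneg_imp_increasing_open[OF \<open>u \<le> v\<close>])
      fix x assume "u < x" "x < v"
      then have "x \<in> {-l<..<l}" using that by simp
      then show "\<exists>y. (f has_real_derivative y) (at x) \<and> 0 \<le> y"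
        using fd D0 by blast
    next
      show "continuous_on {u..v} f"
        by (rule continuous_on_subset[OF cf]) (use that in auto)
    qed
    have f_zero: "0 = f z" if "z \<in> {-l<..<l}" for z
      using le[of "-l" z] le[of z l] that f0 by simp
    have "(f has_real_derivative 0) (at y)"
      by (rule has_field_derivative_transform_within_open[OF DERIV_const _ yl f_zero]) simp_all
    with fd[OF yl] show ?thesis
      by (rule DERIV_unique)
  qed
  have nonconst: False if "\<And>y. y \<in> {-l<..<l} \<Longrightarrow> a' y = 0"
  proof -
    have "a y0 = a l"
    proof (rule const[OF conts(1) nz(1)])
      show "(a has_real_derivative 0) (at y)" if "y \<in> {-l<..<l}" for y
        using at(1)[OF that] \<open>\<And>y. y \<in> {-l<..<l} \<Longrightarrow> a' y = 0\<close>[OF that] by simp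
    qed
    with bc nz show False by simp
  qed
  have "lam > m\<^sup>2"
  proof (rule ccontr)
    assume "\<not> lam > m\<^sup>2"
    then have lam: "m\<^sup>2 - lam \<ge> 0" by simp
    \<comment> \<open>\<open>R' = D\<close> encodes the energy identity
      \<open>\<integral> a''\<^sup>2 + m\<^sup>2 a'\<^sup>2 = (lam - m\<^sup>2) \<integral> a'\<^sup>2 + m\<^sup>2 a\<^sup>2\<close>.\<close>
    define R where "R = (\<lambda>y. (b y + m\<^sup>2 * a y) * a' y - (b' y + m\<^sup>2 * a' y) * a y
       + (2 * m\<^sup>2 - lam) * (a y * a' y))"
    define D where "D = (\<lambda>y. (m\<^sup>2 - lam) * ((a' y)\<^sup>2 + m\<^sup>2 * (a y)\<^sup>2) + m\<^sup>2 * (a' y)\<^sup>2 + (b y + m\<^sup>2 * a y)\<^sup>2)"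
    have D: "D y = 0" if "y \<in> {-l<..<l}" for y
    proof (rule zero_of_nonneg[of R D])
      show "(R has_real_derivative D y) (at y)" if "y \<in> {-l<..<l}" for y
        unfolding R_def
        by (rule derivative_eq_intros refl at that b'[OF that])+
          (simp add: D_def algebra_simps power2_eq_square)
      show "0 \<le> D y" for y using lam by (simp add: D_def)
    qed (use that in \<open>auto simp: R_def bc intro!: continuous_intros cont\<close>)
    have "a' y = 0" if "y \<in> {-l<..<l}" for y
    proof -
      have "m\<^sup>2 * (a' y)\<^sup>2 \<le> D y"
        using lam by (simp add: D_def)
      with D[OF that] have "m\<^sup>2 * (a' y)\<^sup>2 \<le> 0" by simp
      then show ?thesis using m by (simp add: mult_le_0_iff)
    qed
    then show False by (rule nonconst)
  qed
  define \<nu> where "\<nu> = sqrt (lam - m\<^sup>2)"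
  have \<nu>: "\<nu> > 0" "lam = m\<^sup>2 + \<nu>\<^sup>2"
    using \<open>lam > m\<^sup>2\<close> by (auto simp: \<nu>_def)
  have b'': "(b' has_real_derivative - \<nu>\<^sup>2 * b y) (at y)" if "y \<in> {-l<..<l}" for y
    using b'[OF that] by (simp add: \<nu>(2))
  \<comment> \<open>A and B are two first integrals of b'' = -\<open>\<nu>\<^sup>2\<close> b,
    evaluated at l. Their constancy makes them the cosine and sine coefficients of b.\<close>
  define A where "A = b l * cos (\<nu> * l) - b' l * sin (\<nu> * l) / \<nu>"
  define B where "B = b l * sin (\<nu> * l) + b' l * cos (\<nu> * l) / \<nu>"
  have "\<nu> \<noteq> 0" using \<nu> by simp
  have A: "b y * cos (\<nu> * y) - b' y * sin (\<nu> * y) / \<nu> = A" if "y \<in> {-l..l}" for y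
    unfolding A_def
  proof (rule const[of "\<lambda>y. b y * cos (\<nu> * y) - b' y * sin (\<nu> * y) / \<nu>", OF _ that])
    show "((\<lambda>y. b y * cos (\<nu> * y) - b' y * sin (\<nu> * y) / \<nu>) has_real_derivative 0) (at y)"
      if "y \<in> {-l<..<l}" for y
      by (rule derivative_eq_intros refl at[OF that] b''[OF that] \<open>\<nu> \<noteq> 0\<close>)+
        (use \<open>\<nu> \<noteq> 0\<close> in \<open>simp add: field_simps power2_eq_square\<close>)
  qed (use \<open>\<nu> \<noteq> 0\<close> in \<open>auto intro!: continuous_intros cont\<close>)
  have B: "b y * sin (\<nu> * y) + b' y * cos (\<nu> * y) / \<nu> = B" if "y \<in> {-l..l}" for y
    unfolding B_def
  proof (rule const[of "\<lambda>y. b y * sin (\<nu> * y) + b' y * cos (\<nu> * y) / \<nu>", OF _ that])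
    show "((\<lambda>y. b y * sin (\<nu> * y) + b' y * cos (\<nu> * y) / \<nu>) has_real_derivative 0) (at y)"
      if "y \<in> {-l<..<l}" for y
      by (rule derivative_eq_intros refl at[OF that] b''[OF that] \<open>\<nu> \<noteq> 0\<close>)+
        (use \<open>\<nu> \<noteq> 0\<close> in \<open>simp add: field_simps power2_eq_square\<close>)
  qed (use \<open>\<nu> \<noteq> 0\<close> in \<open>auto intro!: continuous_intros cont\<close>)
  have b_eq: "b y = A * cos (\<nu> * y) + B * sin (\<nu> * y)" if "y \<in> {-l..l}" for y
  proof -
    have "A * cos (\<nu> * y) + B * sin (\<nu> * y) = b y * (cos (\<nu> * y) * cos (\<nu> * y) + sin (\<nu> * y) * sin (\<nu> * y))"
      unfolding A[OF that, symmetric] B[OF that, symmetric] by algebra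
    then show ?thesis using sin_cos_squared_add3[of "\<nu> * y"] by simp
  qed
  define q where "q = m\<^sup>2 + \<nu>\<^sup>2"
  have q: "q > 0" using m \<nu> by (simp add: q_def add_pos_pos)
  \<comment> \<open>The derivatives of the first terms of \<open>W\<close> and \<open>V\<close> are \<open>q b cosh (m y)\<close> and \<open>q b sinh (m y)\<close>;
    the other terms integrate these explicitly, so both functions are constant.\<close>
  define W where "W = (\<lambda>y. q * (a' y * cosh (m * y) - m * a y * sinh (m * y))
     - A * (m * sinh (m * y) * cos (\<nu> * y) + \<nu> * cosh (m * y) * sin (\<nu> * y))
     - B * (m * sinh (m * y) * sin (\<nu> * y) - \<nu> * cosh (m * y) * cos (\<nu> * y)))"
  define V where "V = (\<lambda>y. q * (a' y * sinh (m * y) - m * a y * cosh (m * y))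
     - A * (m * cosh (m * y) * cos (\<nu> * y) + \<nu> * sinh (m * y) * sin (\<nu> * y))
     - B * (m * cosh (m * y) * sin (\<nu> * y) - \<nu> * sinh (m * y) * cos (\<nu> * y)))"
  have "W (-l) = W l"
  proof (rule const)
    fix y assume y: "y \<in> {-l<..<l}"
    then have "y \<in> {-l..l}" by simp
    note beq = b_eq[OF this]
    show "(W has_real_derivative 0) (at y)"
      unfolding W_def
      by (rule derivative_eq_intros refl at[OF y])+
        (simp add: beq q_def algebra_simps power2_eq_square)
  qed (use l in \<open>auto simp: W_def intro!: continuous_intros\<close>)
  \<comment> \<open>By \<open>bc\<close> the terms in a and a' vanish at both ends. The factor of B
    is even in y and cancels, while the factor of A is odd. In V the parities are exchanged.\<close>
  then have 1: "A * (m * sinh (m * l) * cos (\<nu> * l) + \<nu> * cosh (m * l) * sin (\<nu> * l)) = 0"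
    by (simp add: W_def bc algebra_simps)
  have "V (-l) = V l"
  proof (rule const)
    fix y assume y: "y \<in> {-l<..<l}"
    then have "y \<in> {-l..l}" by simp
    note beq = b_eq[OF this]
    show "(V has_real_derivative 0) (at y)"
      unfolding V_def
      by (rule derivative_eq_intros refl at[OF y])+
        (simp add: beq q_def algebra_simps power2_eq_square)
  qed (use l in \<open>auto simp: V_def intro!: continuous_intros\<close>)
  then have 2: "B * (m * cosh (m * l) * sin (\<nu> * l) - \<nu> * sinh (m * l) * cos (\<nu> * l)) = 0"
    by (simp add: V_def bc algebra_simps)
  \<comment> \<open>Otherwise b = 0, so a'' = \<open>m\<^sup>2\<close> a, and (a a')' is a sum of
    squares; with a = 0 at the ends this forces a' = 0.\<close>
  have "A \<noteq> 0 \<or> B \<noteq> 0"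
  proof (rule ccontr)
    assume "\<not> (A \<noteq> 0 \<or> B \<noteq> 0)"
    then have b0: "b y = 0" if "y \<in> {-l..l}" for y
      using b_eq[OF that] by simp
    have D: "(a' y)\<^sup>2 + m\<^sup>2 * (a y)\<^sup>2 = 0" if "y \<in> {-l<..<l}" for y
    proof (rule zero_of_nonneg[of "\<lambda>y. a y * a' y" "\<lambda>y. (a' y)\<^sup>2 + m\<^sup>2 * (a y)\<^sup>2"])
      show "((\<lambda>y. a y * a' y) has_real_derivative (a' y)\<^sup>2 + m\<^sup>2 * (a y)\<^sup>2) (at y)"
        if "y \<in> {-l<..<l}" for y
        using that by (auto simp: b0 power2_eq_square algebra_simps intro!: derivative_eq_intros at)
    qed (use that in \<open>auto simp: bc intro!: continuous_intros\<close>)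
    have "a' y = 0" if "y \<in> {-l<..<l}" for y
    proof -
      have "(a' y)\<^sup>2 \<le> (a' y)\<^sup>2 + m\<^sup>2 * (a y)\<^sup>2" by simp
      with D[OF that] show ?thesis by simp
    qed
    then show False by (rule nonconst)
  qed
  with 1 2 have "m * sinh (m * l) * cos (\<nu> * l) + \<nu> * cosh (m * l) * sin (\<nu> * l) = 0 \<or>
     m * cosh (m * l) * sin (\<nu> * l) - \<nu> * sinh (m * l) * cos (\<nu> * l) = 0" by auto
  with \<nu> show ?thesis by (rule that)
qed

subsection \<open>The characteristic equation\<close>

text \<open>With \<open>s = m l\<close> and \<open>t = \<nu> l\<close>, these are, up to positive factors, the integrals of
  \<open>cos (\<nu> y) cosh (m y)\<close> and \<open>sin (\<nu> y) sinh (m y)\<close> over \<open>[-l, l]\<close>.\<close>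

definition even_mode :: "real \<Rightarrow> real \<Rightarrow> real" where
  "even_mode s t = s * sinh s * cos t + t * cosh s * sin t"

definition odd_mode :: "real \<Rightarrow> real \<Rightarrow> real" where
  "odd_mode s t = s * cosh s * sin t - t * sinh s * cos t"

lemma sinh_less_mult_cosh:
  fixes s :: real
  assumes "s > 0"
  shows "sinh s < s * cosh s"
proof -
  have "(\<lambda>x. x * cosh x - sinh x) 0 < (\<lambda>x. x * cosh x - sinh x) s"
  proof (rule DERIV_pos_imp_increasing_open[OF assms])
    fix x :: real assume "0 < x"
    then have "((\<lambda>x. x * cosh x - sinh x) has_real_derivative x * sinh x) (at x)" "x * sinh x > 0"
      by (auto intro!: derivative_eq_intros)
    then show "\<exists>y. ((\<lambda>x. x * cosh x - sinh x) has_real_derivative y) (at x) \<and> y > 0"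
      by blast
  qed (intro continuous_intros)
  then show ?thesis by simp
qed

lemma mult_cos_less_sin:
  fixes t :: real
  assumes "0 < t" "t \<le> pi"
  shows "t * cos t < sin t"
proof -
  have "(\<lambda>x. sin x - x * cos x) 0 < (\<lambda>x. sin x - x * cos x) t"
  proof (rule DERIV_pos_imp_increasing_open[OF assms(1)])
    fix x :: real assume "0 < x" "x < t"
    then have "sin x > 0" using assms by (simp add: sin_gt_zero)
    with \<open>0 < x\<close>
    have "((\<lambda>x. sin x - x * cos x) has_real_derivative x * sin x) (at x)" "x * sin x > 0"
      by (auto intro!: derivative_eq_intros)
    then show "\<exists>y. ((\<lambda>x. sin x - x * cos x) has_real_derivative y) (at x) \<and> y > 0"
      by blast
  qed (intro continuous_intros)
  then show ?thesis by simp
qed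

text \<open>Divided by sinh s sin t, the claim is s coth s > 1 > t cot t. Consequently odd roots
  have t \<ge> pi.\<close>

lemma odd_mode_pos:
  assumes "s > 0" "0 < t" "t < pi"
  shows "odd_mode s t > 0"
proof -
  have sin: "sin t > 0" using assms by (simp add: sin_gt_zero)
  have "t * sinh s * cos t \<le> sinh s * sin t"
    using mult_cos_less_sin[of t] assms mult_left_mono[of "t * cos t" "sin t" "sinh s"]
    by (simp add: mult_ac)
  also have "\<dots> < s * cosh s * sin t"
    using sinh_less_mult_cosh[OF assms(1)] sin by simp
  finally show ?thesis by (simp add: odd_mode_def)
qed

lemma even_mode_pos:
  assumes "s > 0" "0 < t" "t \<le> pi / 2"
  shows "even_mode s t > 0"
proof -
  have "sin t > 0" "cos t \<ge> 0"
    using assms by (auto intro!: sin_gt_zero cos_ge_zero)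
  with assms show ?thesis
    unfolding even_mode_def by (intro add_nonneg_pos) simp_all
qed

text \<open>At \<open>s = 0\<close> the first even root is \<open>t = \<pi>\<close>. A root with \<open>s\<^sup>2 + t\<^sup>2 < \<pi>\<^sup>2\<close> forces the minimum
  of \<open>s\<^sup>2 + t\<^sup>2\<close> away from \<open>s = 0\<close>, and from all roots with \<open>t \<ge> \<pi>\<close>, odd ones included.\<close>

lemma even_mode_zero_small:
  obtains t where "pi / 2 \<le> t" "t \<le> pi" "even_mode 1 t = 0" "1 + t\<^sup>2 < pi\<^sup>2"
proof -
  have pi: "157 / 50 < pi" "pi < 63 / 20"
    using pi_approx by simp_all
  \<comment> \<open>74/25 is close enough to pi to make the even mode nonpositive at s = 1 (d <
    0.19), yet small enough for 1 + \<open>t0\<^sup>2\<close> to stay below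
    \<open>3.14\<^sup>2\<close>.\<close>
  define t0 :: real where "t0 = 74 / 25"
  define d where "d = pi - t0"
  have d: "0 < d" "d < 19 / 100" using pi by (simp_all add: d_def t0_def)
  have trig: "cos t0 = - cos d" "sin t0 = sin d"
    using cos_pi_minus[of d] sin_pi_minus[of d] by (simp_all add: d_def)
  have "sin d \<le> 19 / 100" using sin_x_le_x[of d] d by simp
  have "(sin (d / 2))\<^sup>2 \<le> (d / 2)\<^sup>2"
    using abs_sin_x_le_abs_x[of "d / 2"] by (simp only: abs_le_square_iff)
  then have "cos d \<ge> 1 - d\<^sup>2 / 2"
    using cos_double_sin[of "d / 2"] by (simp add: power_divide)
  moreover have "d\<^sup>2 \<le> (19 / 100)\<^sup>2" using d by (intro power_mono) auto
  ultimately have "cos d \<ge> 49 / 50" by (simp add: power2_eq_square)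
  have e: "exp 1 \<ge> (2 :: real)" using exp_ge_add_one_self[of "1 :: real"] by simp
  then have e2: "exp 1 * exp 1 \<ge> (2 * 2 :: real)" by (intro mult_mono) auto
  \<comment> \<open>The bound tanh 1 \<ge> 3/5 is equivalent to e * e \<ge> 4. It suffices, since
    3/5 * 49/50 = 0.588 exceeds 74/25 * 19/100 = 0.5624.\<close>
  have "sinh 1 \<ge> 3 / 5 * cosh (1 :: real)"
    using e e2 by (simp add: sinh_field_def cosh_field_def exp_minus field_simps)
  then have "3 / 5 * cosh 1 * (49 / 50) \<le> sinh 1 * cos d"
    using \<open>cos d \<ge> 49 / 50\<close> by (intro mult_mono) auto
  moreover have "t0 * cosh 1 * sin d \<le> 74 / 25 * cosh 1 * (19 / 100)"
    using \<open>sin d \<le> 19 / 100\<close> by (simp add: t0_def)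
  moreover have "cosh (1 :: real) > 0" by simp
  ultimately have "t0 * cosh 1 * sin d \<le> sinh 1 * cos d" by linarith
  then have "even_mode 1 t0 \<le> 0"
    by (simp add: even_mode_def trig)
  moreover have "0 \<le> even_mode 1 (pi / 2)"
    using even_mode_pos[of 1 "pi / 2"] by simp
  moreover have "pi / 2 \<le> t0" using pi by (simp add: t0_def)
  moreover have "continuous_on {pi / 2..t0} (even_mode 1)"
    unfolding even_mode_def by (intro continuous_intros)
  ultimately obtain t where t: "pi / 2 \<le> t" "t \<le> t0" "even_mode 1 t = 0"
    using IVT2'[of "even_mode 1" t0 0 "pi / 2"] by auto
  have "t\<^sup>2 \<le> t0\<^sup>2" using t pi by (intro power_mono) auto
  moreover have "(157 / 50)\<^sup>2 < pi\<^sup>2" using pi by (intro power_strict_mono) auto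
  ultimately have "1 + t\<^sup>2 < pi\<^sup>2" by (simp add: t0_def power2_eq_square)
  with t pi show thesis by (intro that[of t]) (auto simp: t0_def)
qed

text \<open>The minimum is taken over a compact set C of even roots and lies below
  \<open>pi\<^sup>2\<close>. Every competitor outside C has s' \<ge> pi or t' \<ge> pi, hence a sum
  of squares of at least \<open>pi\<^sup>2\<close>.\<close>

lemma optimal_mode:
  obtains s t where "s > 0" "pi / 2 < t" "t < pi" "even_mode s t = 0"
    "\<And>s' t'. s' > 0 \<Longrightarrow> t' > 0 \<Longrightarrow> even_mode s' t' = 0 \<or> odd_mode s' t' = 0 \<Longrightarrow>
       s\<^sup>2 + t\<^sup>2 \<le> s'\<^sup>2 + t'\<^sup>2"
proof -
  define C where "C = ({0..pi} \<times> {pi / 2..pi}) \<inter> {p. even_mode (fst p) (snd p) = 0}"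
  obtain t1 where t1: "pi / 2 \<le> t1" "t1 \<le> pi" "even_mode 1 t1 = 0" "1 + t1\<^sup>2 < pi\<^sup>2"
    by (rule even_mode_zero_small)
  have "compact C"
    unfolding C_def even_mode_def
    by (intro compact_Int_closed compact_Times compact_Icc closed_Collect_eq continuous_intros)
  moreover have "(1, t1) \<in> C"
    using t1 pi_gt3 by (simp add: C_def)
  then have "C \<noteq> {}" by auto
  moreover have "continuous_on C (\<lambda>p. (fst p)\<^sup>2 + (snd p)\<^sup>2)"
    by (intro continuous_intros)
  ultimately obtain p where p: "p \<in> C" "\<And>q. q \<in> C \<Longrightarrow> (fst p)\<^sup>2 + (snd p)\<^sup>2 \<le> (fst q)\<^sup>2 + (snd q)\<^sup>2"
    using continuous_attains_inf[of C "\<lambda>p. (fst p)\<^sup>2 + (snd p)\<^sup>2"] by blast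
  obtain s t where st: "p = (s, t)" by (cases p)
  have C: "0 \<le> s" "s \<le> pi" "pi / 2 \<le> t" "t \<le> pi" "even_mode s t = 0"
    using p(1) by (auto simp: C_def st)
  have min: "s\<^sup>2 + t\<^sup>2 \<le> s'\<^sup>2 + t'\<^sup>2" if "(s', t') \<in> C" for s' t'
    using p(2)[OF that] by (simp add: st)
  have lt: "s\<^sup>2 + t\<^sup>2 < pi\<^sup>2"
    using min[OF \<open>(1, t1) \<in> C\<close>] t1(4) by simp
  have "t < pi"
    using lt C(4) zero_le_power2[of s] by (cases "t = pi") auto
  \<comment> \<open>C includes s = 0 for compactness, but there the equation reads t sin t = 0,
    which has no solution with 0 < t < pi.\<close>
  have "s \<noteq> 0"
  proof
    assume "s = 0"
    then have "t * sin t = 0" using C(5) by (simp add: even_mode_def)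
    moreover have "t > 0" using C(3) pi_gt_zero by linarith
    ultimately show False using sin_gt_zero[of t] \<open>t < pi\<close> by simp
  qed
  then have "s > 0" using C(1) by simp
  have "t \<noteq> pi / 2" using even_mode_pos[OF \<open>s > 0\<close>, of t] C(5) pi_gt_zero by force
  then have "t > pi / 2" using C(3) by simp
  show thesis
  proof (rule that[OF \<open>s > 0\<close> \<open>t > pi / 2\<close> \<open>t < pi\<close> C(5)])
    fix s' t' :: real
    assume pos: "s' > 0" "t' > 0" and zero: "even_mode s' t' = 0 \<or> odd_mode s' t' = 0"
    consider "t' \<ge> pi" | "s' \<ge> pi" | "s' < pi" "t' < pi" by linarith
    then show "s\<^sup>2 + t\<^sup>2 \<le> s'\<^sup>2 + t'\<^sup>2"
    proof cases
      case 1
      then have "pi\<^sup>2 \<le> t'\<^sup>2" by (intro power_mono) auto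
      with lt zero_le_power2[of s'] show ?thesis by linarith
    next
      case 2
      then have "pi\<^sup>2 \<le> s'\<^sup>2" by (intro power_mono) auto
      with lt zero_le_power2[of t'] show ?thesis by linarith
    next
      case 3
      with zero odd_mode_pos[OF pos] have "even_mode s' t' = 0" by simp
      moreover from this even_mode_pos[OF pos] have "pi / 2 \<le> t'" by force
      ultimately have "(s', t') \<in> C" using 3 pos by (simp add: C_def)
      then show ?thesis by (rule min)
    qed
  qed
qed

section \<open>Sign of the even profile\<close>

text \<open>The quotient sin x / x strictly decreases on (0, pi], so sine lies above its chord from
  the origin. The next lemma is the opposite inequality for sinh, where sinh x / x
  increases.\<close>

lemma sin_gt_chord:
  fixes r t :: real
  assumes "0 < r" "r < 1" "0 < t" "t \<le> pi"
  shows "sin (t * r) > r * sin t"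
proof -
  have rt: "0 < t * r" "t * r < t" using assms by auto
  have "(\<lambda>x. sin x / x) t < (\<lambda>x. sin x / x) (t * r)"
  proof (rule DERIV_neg_imp_decreasing_open[OF rt(2)])
    fix x assume x: "t * r < x" "x < t"
    then have "x > 0" using rt by linarith
    moreover from this have "x * cos x < sin x"
      using x assms mult_cos_less_sin[of x] by simp
    ultimately have "((\<lambda>x. sin x / x) has_real_derivative (x * cos x - sin x) / (x * x)) (at x)"
      "(x * cos x - sin x) / (x * x) < 0"
      by (auto intro!: derivative_eq_intros divide_neg_pos simp: mult_ac)
    then show "\<exists>y. ((\<lambda>x. sin x / x) has_real_derivative y) (at x) \<and> y < 0"
      by blast
  qed (use rt in \<open>auto intro!: continuous_intros\<close>)
  then show ?thesis using assms by (simp add: field_simps)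
qed

lemma sinh_less_chord:
  fixes r s :: real
  assumes "0 < r" "r < 1" "0 < s"
  shows "sinh (s * r) < r * sinh s"
proof -
  have rs: "0 < s * r" "s * r < s" using assms by auto
  have "(\<lambda>x. sinh x / x) (s * r) < (\<lambda>x. sinh x / x) s"
  proof (rule DERIV_pos_imp_increasing_open[OF rs(2)])
    fix x assume x: "s * r < x" "x < s"
    then have "x > 0" using rs by linarith
    moreover from this have "x * cosh x > sinh x"
      by (rule sinh_less_mult_cosh)
    ultimately have "((\<lambda>x. sinh x / x) has_real_derivative (x * cosh x - sinh x) / (x * x)) (at x)"
      "(x * cosh x - sinh x) / (x * x) > 0"
      by (auto intro!: derivative_eq_intros divide_pos_pos simp: mult_ac)
    then show "\<exists>y. ((\<lambda>x. sinh x / x) has_real_derivative y) (at x) \<and> y > 0"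
      by blast
  qed (use rs in \<open>auto intro!: continuous_intros\<close>)
  then show ?thesis using assms by (simp add: field_simps)
qed

text \<open>The profile is even in r and vanishes at r = 1, so it suffices that it strictly
  increases on (0, 1). The chord inequalities place its derivative at x above x *
  \<open>even_mode s t\<close> = 0; the sinh inequality is reversed by cos t < 0.\<close>

lemma even_profile_neg:
  fixes s t r :: real
  assumes "s > 0" "pi / 2 < t" "t < pi" "even_mode s t = 0" "\<bar>r\<bar> < 1"
  shows "cosh (s * r) * cos t - cosh s * cos (t * r) < 0"
proof -
  define f where "f = (\<lambda>r. cosh (s * r) * cos t - cosh s * cos (t * r))"
  have t: "t > 0" using assms(2) pi_gt_zero by linarith
  have "cos t < 0"
    using assms cos_lt_zero_pi[of t] by simp
  have "f \<bar>r\<bar> < f 1"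
  proof (rule DERIV_pos_imp_increasing_open[OF assms(5)])
    fix x assume "\<bar>r\<bar> < x" "x < 1"
    then have x: "0 < x" "x < 1" by auto
    have "0 = x * even_mode s t" using assms(4) by simp
    also have "\<dots> = s * (x * sinh s) * cos t + t * cosh s * (x * sin t)"
      by (simp add: even_mode_def algebra_simps)
    also have "\<dots> < s * sinh (s * x) * cos t + t * cosh s * sin (t * x)"
      using sinh_less_chord[OF x \<open>s > 0\<close>] sin_gt_chord[OF x t] assms t \<open>cos t < 0\<close>
      by (intro add_strict_mono mult_strict_right_mono_neg mult_strict_left_mono) auto
    finally have "0 < s * sinh (s * x) * cos t + t * cosh s * sin (t * x)" .
    moreover have "(f has_real_derivative s * sinh (s * x) * cos t + t * cosh s * sin (t * x)) (at x)"
      unfolding f_def by (auto intro!: derivative_eq_intros)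
    ultimately show "\<exists>y. (f has_real_derivative y) (at x) \<and> y > 0" by blast
  qed (auto simp: f_def intro!: continuous_intros)
  moreover have "f 1 = 0" by (simp add: f_def)
  moreover have "f \<bar>r\<bar> = f r" by (cases "r \<ge> 0") (simp_all add: f_def)
  ultimately show ?thesis by (simp add: f_def)
qed

subsection \<open>The separated eigenfunction\<close>

lemma Dx_tensor:
  assumes "\<And>x. (f has_real_derivative f' x) (at x)"
  shows "Dx (\<lambda>(x, y). f x * g y) = (\<lambda>(x, y). f' x * g y)"
proof -
  have "((\<lambda>t. f t * g y) has_real_derivative f' x * g y) (at x)" for x y
    by (intro DERIV_cmult_right assms)
  then show ?thesis by (auto simp: Dx_def DERIV_imp_deriv)
qed

lemma Dy_tensor:
  assumes "\<And>y. (g has_real_derivative g' y) (at y)"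
  shows "Dy (\<lambda>(x, y). f x * g y) = (\<lambda>(x, y). f x * g' y)"
proof -
  have "((\<lambda>t. f x * g t) has_real_derivative f x * g' y) (at y)" for x y
    by (intro DERIV_cmult assms)
  then show ?thesis by (auto simp: Dy_def DERIV_imp_deriv)
qed

text \<open>The families f and g list the successive derivatives of the two factors. Partial
  differentiation only shifts an index, so the induction closes when i and j are arbitrary.\<close>

lemma Ck_tensor:
  fixes f g :: "nat \<Rightarrow> real \<Rightarrow> real"
  assumes f: "\<And>i x. (f i has_real_derivative f (Suc i) x) (at x)"
    and g: "\<And>j y. (g j has_real_derivative g (Suc j) y) (at y)"
  shows "Ck n UNIV (\<lambda>(x, y). f i x * g j y)"
proof (induction n arbitrary: i j)
  have cont: "continuous_on UNIV (f i)" "continuous_on UNIV (g j)" for i j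
    by (rule DERIV_continuous_on[OF f], rule DERIV_continuous_on[OF g])
  have tensor: "continuous_on UNIV (\<lambda>(x, y). f i x * g j y)" for i j
    unfolding case_prod_unfold
    by (intro continuous_on_mult continuous_on_compose2[OF cont(1)] continuous_on_compose2[OF cont(2)]
        continuous_intros) auto
  {
    case 0
    show ?case by (simp add: tensor)
  next
    case (Suc n)
    have "(\<lambda>t. f i t * g j y) differentiable at x" "(\<lambda>t. f i x * g j t) differentiable at y" for x y
      unfolding real_differentiable_def
      using DERIV_cmult_right[OF f] DERIV_cmult[OF g] by blast+
    then show ?case
      using Suc.IH tensor[of i j] by (simp add: Dx_tensor[OF f] Dy_tensor[OF g])
  }
qed

lemma Lap_tensor:
  assumes "\<And>x. (f has_real_derivative f1 x) (at x)" "\<And>x. (f1 has_real_derivative f2 x) (at x)"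
    and "\<And>y. (g has_real_derivative g1 y) (at y)" "\<And>y. (g1 has_real_derivative g2 y) (at y)"
  shows "Lap (\<lambda>(x, y). f x * g y) = (\<lambda>(x, y). f2 x * g y + f x * g2 y)"
  unfolding Lap_def
  by (auto simp: Dx_tensor[OF assms(1)] Dx_tensor[OF assms(2)] Dy_tensor[OF assms(3)] Dy_tensor[OF assms(4)])

text \<open>A phase shift by pi/2 per differentiation gives all derivatives of sine in one formula,
  as \<open>Ck_tensor\<close> requires.\<close>

lemma sine_derivatives:
  fixes k :: real
  shows "((\<lambda>x. k ^ i * sin (k * x + real i * (pi / 2))) has_real_derivative
     k ^ Suc i * sin (k * x + real (Suc i) * (pi / 2))) (at x)"
proof -
  have "sin (k * x + real (Suc i) * (pi / 2)) = cos (k * x + real i * (pi / 2))"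
    using sin_add[of "k * x + real i * (pi / 2)" "pi / 2"]
    by (simp add: algebra_simps add_divide_distrib)
  then show ?thesis
    by (auto intro!: derivative_eq_intros)
qed

text \<open>The even solution of the clamped problem in y. The coefficients are chosen so that it
  vanishes at y = l; the slope there is \<open>even_mode s t\<close> / l.\<close>

definition profile :: "real \<Rightarrow> real \<Rightarrow> real \<Rightarrow> real \<Rightarrow> real" where
  "profile l s t y = cosh (s / l * y) * cos t - cosh s * cos (t / l * y)"

lemma profile_neg:
  assumes "l > 0" "s > 0" "pi / 2 < t" "t < pi" "even_mode s t = 0" "y \<in> {-l<..<l}"
  shows "profile l s t y < 0"
  using even_profile_neg[OF assms(2-5), of "y / l"] assms(1,6)
  by (simp add: profile_def abs_less_iff field_simps)

text \<open>As k l = s, the cosh term times sin (k x) is harmonic. The Laplacian therefore leaves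
  only a multiple of sin (k x) cos (t y / l), which it maps to -(\<open>s\<^sup>2\<close> +
  \<open>t\<^sup>2\<close>) / \<open>l\<^sup>2\<close> times itself.\<close>

lemma eigenpair_profile:
  fixes s t l :: real and k :: nat
  assumes l: "l > 0" and k: "k \<ge> 1" "real k * l = s"
    and t: "pi / 2 < t" "t < pi" "even_mode s t = 0"
  shows "eigenpair l ((s\<^sup>2 + t\<^sup>2) / l\<^sup>2) (\<lambda>(x, y). sin (real k * x) * profile l s t y)"
proof -
  define \<kappa> where "\<kappa> = real k"
  define \<nu> where "\<nu> = t / l"
  have \<kappa>: "\<kappa> > 0" "\<kappa> * l = s" and \<nu>: "\<nu> * l = t"
    using l k by (auto simp: \<kappa>_def \<nu>_def)
  have "s > 0" using k l by (metis \<kappa> mult_pos_pos)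
  have profile: "profile l s t = (\<lambda>y. cosh (\<kappa> * y) * cos t - cosh s * cos (\<nu> * y))"
    using \<kappa>(2)[symmetric] l by (simp add: profile_def \<nu>_def fun_eq_iff)
  define p1 where "p1 = (\<lambda>y. \<kappa> * sinh (\<kappa> * y) * cos t + \<nu> * cosh s * sin (\<nu> * y))"
  define p2 where "p2 = (\<lambda>y. \<kappa>\<^sup>2 * cosh (\<kappa> * y) * cos t + \<nu>\<^sup>2 * cosh s * cos (\<nu> * y))"
  define c where "c = (\<kappa>\<^sup>2 + \<nu>\<^sup>2) * cosh s"
  define u where "u = (\<lambda>(x, y). sin (\<kappa> * x) * profile l s t y)"
  have sin: "((\<lambda>x. sin (\<kappa> * x)) has_real_derivative \<kappa> * cos (\<kappa> * x)) (at x)"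
    "((\<lambda>x. \<kappa> * cos (\<kappa> * x)) has_real_derivative - \<kappa>\<^sup>2 * sin (\<kappa> * x)) (at x)" for x
    by (auto intro!: derivative_eq_intros simp: power2_eq_square)
  have p: "(profile l s t has_real_derivative p1 y) (at y)" "(p1 has_real_derivative p2 y) (at y)" for y
    unfolding profile p1_def p2_def
    by (auto intro!: derivative_eq_intros simp: power2_eq_square algebra_simps)
  have q: "((\<lambda>y. c * cos (\<nu> * y)) has_real_derivative - \<nu> * c * sin (\<nu> * y)) (at y)"
    "((\<lambda>y. - \<nu> * c * sin (\<nu> * y)) has_real_derivative - \<nu>\<^sup>2 * (c * cos (\<nu> * y))) (at y)" for y
    by (auto intro!: derivative_eq_intros simp: power2_eq_square algebra_simps)
  have Lap_u: "Lap u = (\<lambda>(x, y). sin (\<kappa> * x) * (c * cos (\<nu> * y)))"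
    unfolding u_def Lap_tensor[OF sin p]
    by (auto simp: fun_eq_iff profile p2_def c_def algebra_simps)
  have LapLap_u: "Lap (Lap u) = (\<lambda>(x, y). - (\<kappa>\<^sup>2 + \<nu>\<^sup>2) * (sin (\<kappa> * x) * (c * cos (\<nu> * y))))"
    unfolding Lap_u Lap_tensor[OF sin q] by (auto simp: fun_eq_iff algebra_simps)
  have lam: "(s\<^sup>2 + t\<^sup>2) / l\<^sup>2 = \<kappa>\<^sup>2 + \<nu>\<^sup>2"
    using l by (simp add: \<kappa>(2)[symmetric] \<nu>[symmetric] power_mult_distrib add_divide_distrib)
  define f where "f = (\<lambda>i x. \<kappa> ^ i * sin (\<kappa> * x + real i * (pi / 2)))"
  \<comment> \<open>\<open>g j\<close> is the j-th derivative of the profile: cosh is split into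
    exponentials, and cosine is a sine shifted by a quarter period.\<close>
  define g where "g = (\<lambda>j y. cos t * (\<kappa> ^ j * (exp (\<kappa> * y) + (- 1) ^ j * exp (- (\<kappa> * y))) / 2)
      - cosh s * (\<nu> ^ j * sin (\<nu> * (y + pi / 2 / \<nu>) + real j * (pi / 2))))"
  have "\<nu> > 0" using l t pi_gt_zero by (simp add: \<nu>_def)
  have "(f i has_real_derivative f (Suc i) x) (at x)" for i x
    unfolding f_def by (rule sine_derivatives)
  moreover have "(g j has_real_derivative g (Suc j) y) (at y)" for j y
  proof -
    have "((\<lambda>y. \<nu> ^ j * sin (\<nu> * (y + pi / 2 / \<nu>) + real j * (pi / 2))) has_real_derivative
       \<nu> ^ Suc j * sin (\<nu> * (y + pi / 2 / \<nu>) + real (Suc j) * (pi / 2))) (at y)"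
      using sine_derivatives[of \<nu> j "y + pi / 2 / \<nu>"] by (simp only: DERIV_shift)
    moreover have "((\<lambda>y. \<kappa> ^ j * (exp (\<kappa> * y) + (- 1) ^ j * exp (- (\<kappa> * y))) / 2) has_real_derivative
       \<kappa> ^ Suc j * (exp (\<kappa> * y) + (- 1) ^ Suc j * exp (- (\<kappa> * y))) / 2) (at y)"
      by (auto intro!: derivative_eq_intros simp: field_simps)
    ultimately show ?thesis
      unfolding g_def by (intro DERIV_diff DERIV_cmult)
  qed
  ultimately have "Ck 4 UNIV (\<lambda>(x, y). f 0 x * g 0 y)"
    by (rule Ck_tensor)
  also have "(\<lambda>(x, y). f 0 x * g 0 y) = u"
  proof -
    have "\<nu> * (y + pi / 2 / \<nu>) = \<nu> * y + pi / 2" for y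
      using \<open>\<nu> > 0\<close> by (simp add: distrib_left)
    then have "g 0 = profile l s t"
      by (simp add: fun_eq_iff g_def profile cosh_field_def sin_add mult.commute)
    then show ?thesis by (simp add: f_def u_def)
  qed
  finally have Ck: "Ck 4 UNIV u" .
  have "l * (\<kappa> * sinh s * cos t + \<nu> * cosh s * sin t) = even_mode s t"
    by (simp add: even_mode_def \<kappa>(2)[symmetric] \<nu>[symmetric] algebra_simps)
  then have "\<kappa> * sinh s * cos t + \<nu> * cosh s * sin t = 0"
    using t(3) l by simp
  then have ends: "profile l s t l = 0" "profile l s t (- l) = 0" "p1 l = 0" "p1 (- l) = 0"
    unfolding profile p1_def by (simp_all add: \<kappa>(2) \<nu>)
  have sin_pi: "sin (\<kappa> * pi) = 0" by (simp add: \<kappa>_def)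
  have Dxx: "Dx (Dx u) = (\<lambda>(x, y). - \<kappa>\<^sup>2 * sin (\<kappa> * x) * profile l s t y)"
    unfolding u_def Dx_tensor[OF sin(1)] Dx_tensor[OF sin(2)] ..
  have Dyu: "Dy u = (\<lambda>(x, y). sin (\<kappa> * x) * p1 y)"
    unfolding u_def Dy_tensor[OF p(1)] ..
  have "eigenpair l (\<kappa>\<^sup>2 + \<nu>\<^sup>2) u"
    unfolding eigenpair_def
  proof (intro conjI)
    show "\<exists>U. open U \<and> Omega_cl l \<subseteq> U \<and> Ck 4 U u"
      using Ck by (intro exI[of _ UNIV]) simp
    have "(pi / 2 / \<kappa>, 0) \<in> Omega l"
      using l k by (auto simp: Omega_def \<kappa>_def field_simps)
    moreover have "u (pi / 2 / \<kappa>, 0) \<noteq> 0"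
      using profile_neg[OF l \<open>s > 0\<close> t, of 0] l \<kappa>(1) by (simp add: u_def)
    ultimately show "\<exists>p\<in>Omega l. u p \<noteq> 0" by blast
    show "\<forall>p\<in>Omega l. Lap (Lap u) p = - (\<kappa>\<^sup>2 + \<nu>\<^sup>2) * Lap u p"
      unfolding LapLap_u unfolding Lap_u by auto
    show "\<forall>p\<in>Omega_cl l - Omega l. u p = 0"
    proof
      fix p assume "p \<in> Omega_cl l - Omega l"
      then obtain x y where xy: "p = (x, y)" "x = 0 \<or> x = pi \<or> y = -l \<or> y = l"
        by (cases p) (force simp: Omega_cl_def Omega_def)
      then show "u p = 0" using ends sin_pi by (auto simp: u_def)
    qed
    show "\<forall>x\<in>{0<..<pi}. Dy u (x, - l) = 0 \<and> Dy u (x, l) = 0"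
      by (simp add: Dyu ends)
    show "\<forall>y\<in>{-l<..<l}. Dx (Dx u) (0, y) = 0 \<and> Dx (Dx u) (pi, y) = 0"
      by (simp add: Dxx sin_pi)
  qed
  then show ?thesis
    by (simp add: lam u_def \<kappa>_def)
qed

text \<open>The zeros of sin (k x) cut the rectangle into k open strips. A partition of the nonzero
  set into disjoint nonempty open connected sets is its family of components.\<close>

lemma nodal_domains_sine_product:
  fixes k :: nat
  assumes "l > 0" "k \<ge> 1" and \<phi>: "\<And>y. y \<in> {-l<..<l} \<Longrightarrow> \<phi> y \<noteq> 0"
  defines "u \<equiv> \<lambda>(x, y). sin (real k * x) * \<phi> y"
  shows "finite (nodal_domains l u)" "card (nodal_domains l u) = k"
proof -
  define I where "I = (\<lambda>j :: nat. {real j * pi / k<..<real (Suc j) * pi / k})"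
  have k: "real k > 0" using assms by simp
  have mem_I: "x \<in> I j \<longleftrightarrow> real j < real k * x / pi \<and> real k * x / pi < real j + 1" for x j
    using k by (auto simp: I_def field_simps)
  have mid: "(real j + 1 / 2) * pi / k \<in> I j" for j
    unfolding mem_I using k by simp
  have disj: "i = j" if "x \<in> I i" "x \<in> I j" for x i j
  proof -
    have "real i < real j + 1" "real j < real i + 1" using that by (auto simp: mem_I)
    then show ?thesis by linarith
  qed
  define A where "A = (\<lambda>j. I j \<times> {-l<..<l}) ` {..<k}"
  have inj: "inj_on (\<lambda>j. I j \<times> {-l<..<l}) {..<k}"
  proof (rule inj_onI)
    fix i j assume "I i \<times> {-l<..<l} = I j \<times> {-l<..<l}"
    moreover have "((real i + 1 / 2) * pi / k, 0) \<in> I i \<times> {-l<..<l}"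
      using mid[of i] \<open>l > 0\<close> by simp
    ultimately have "(real i + 1 / 2) * pi / k \<in> I j" by auto
    then show "i = j" using disj mid by blast
  qed
  have "components {p \<in> Omega l. u p \<noteq> 0} = A"
  proof (rule components_open_unique)
    show "pairwise disjnt A"
      by (auto simp: A_def pairwise_def disjnt_def dest: disj)
    show "open X \<and> connected X \<and> X \<noteq> {}" if "X \<in> A" for X
    proof -
      from that obtain j where X: "X = I j \<times> {-l<..<l}" by (auto simp: A_def)
      have "((real j + 1 / 2) * pi / k, 0) \<in> X"
        using mid[of j] \<open>l > 0\<close> by (simp add: X)
      then show ?thesis
        unfolding X by (auto simp: I_def intro!: open_Times connected_Times)
    qed
    have "(\<exists>j<k. x \<in> I j) \<longleftrightarrow> x \<in> {0<..<pi} \<and> sin (real k * x) \<noteq> 0" for x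
    proof
      assume "\<exists>j<k. x \<in> I j"
      then obtain j where j: "j < k" "real j < k * x / pi" "k * x / pi < real j + 1"
        by (auto simp: mem_I)
      have "0 < k * x / pi" "k * x / pi < k" using j by linarith+
      then have "x \<in> {0<..<pi}" using k by (simp add: zero_less_divide_iff zero_less_mult_iff field_simps)
      moreover have "sin (real k * x) \<noteq> 0"
      proof
        assume "sin (real k * x) = 0"
        then obtain i :: int where "real k * x = of_int i * pi"
          by (auto simp: sin_zero_iff_int2)
        then have "k * x / pi = of_int i" by simp
        with j have "of_int (int j) < (of_int i :: real)" "of_int i < (of_int (int j + 1) :: real)"
          by simp_all
        then show False by (simp only: of_int_less_iff)
      qed
      ultimately show "x \<in> {0<..<pi} \<and> sin (real k * x) \<noteq> 0" ..
    next
      assume x: "x \<in> {0<..<pi} \<and> sin (real k * x) \<noteq> 0"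
      define z where "z = k * x / pi"
      have z: "0 < z" "z < k" using x k by (auto simp: z_def field_simps)
      \<comment> \<open>The strip index is the floor of k x / pi. An integer value of this quotient
        would be a zero of sin (k x), so x lies strictly inside the strip.\<close>
      define j where "j = nat \<lfloor>z\<rfloor>"
      have j: "real j = of_int \<lfloor>z\<rfloor>" using z by (simp add: j_def)
      have "real j \<noteq> z"
      proof
        assume "real j = z"
        moreover have "real k * x = z * pi" by (simp add: z_def)
        ultimately have "real k * x = of_int \<lfloor>z\<rfloor> * pi" using j by (simp only:)
        with x show False by (metis sin_zero_iff_int2)
      qed
      moreover have "real j \<le> z" "z < real j + 1" unfolding j by linarith+
      ultimately have "real j < z" "z < real j + 1" by simp_all
      then have "x \<in> I j" "j < k" using z by (auto simp: mem_I z_def)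
      then show "\<exists>j<k. x \<in> I j" by blast
    qed
    note * = this
    have "(x, y) \<in> \<Union> A \<longleftrightarrow> (x, y) \<in> {p \<in> Omega l. u p \<noteq> 0}" for x y
    proof -
      have "(x, y) \<in> \<Union> A \<longleftrightarrow> (\<exists>j<k. x \<in> I j) \<and> y \<in> {-l<..<l}"
        by (auto simp: A_def)
      then show ?thesis
        unfolding * using \<phi>[of y] by (auto simp: Omega_def u_def)
    qed
    then show "\<Union> A = {p \<in> Omega l. u p \<noteq> 0}" by auto
  qed
  moreover have "card A = k" "finite A"
    using inj by (simp_all add: A_def card_image)
  ultimately show "finite (nodal_domains l u)" "card (nodal_domains l u) = k"
    by (simp_all add: nodal_domains_def)
qed

subsection \<open>The first eigenvalue\<close>

lemma Dy_eq_0: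
  assumes "\<And>t. t \<in> {a<..<b} \<Longrightarrow> u (x, t) = 0" "y \<in> {a<..<b}"
  shows "Dy u (x, y) = 0"
proof -
  have "((\<lambda>t. u (x, t)) has_real_derivative 0) (at y)"
    by (rule has_field_derivative_transform_within_open[OF DERIV_const _ assms(2)])
      (simp_all add: assms(1))
  then show ?thesis by (simp add: Dy_def DERIV_imp_deriv)
qed

text \<open>The boundary conditions on the derivatives hold for x in the open interval only; its two
  endpoints do not affect the integral.\<close>

lemma sine_coeff_eq_0:
  assumes "\<And>x. x \<in> {0<..<pi} \<Longrightarrow> v (x, y) = 0"
  shows "sine_coeff m v y = 0"
proof -
  have "sine_coeff m v y = integral {0<..<pi} (\<lambda>x. v (x, y) * sin (real m * x))"
    by (simp add: sine_coeff_def integral_open_interval_real)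
  also have "\<dots> = integral {0<..<pi} (\<lambda>x. 0)"
    by (rule integral_cong) (simp add: assms)
  finally show ?thesis by simp
qed

lemma sine_coeff_scale:
  assumes "\<And>x. x \<in> {0<..<pi} \<Longrightarrow> w (x, y) = c * v (x, y)"
  shows "sine_coeff m w y = c * sine_coeff m v y"
proof -
  have "sine_coeff m w y = integral {0<..<pi} (\<lambda>x. w (x, y) * sin (real m * x))"
    by (simp add: sine_coeff_def integral_open_interval_real)
  also have "\<dots> = integral {0<..<pi} (\<lambda>x. c * (v (x, y) * sin (real m * x)))"
    by (rule integral_cong) (simp add: assms)
  finally show ?thesis by (simp add: sine_coeff_def integral_open_interval_real)
qed

text \<open>At a height where u is not identically zero, completeness provides a nonzero sine
  coefficient. This coefficient and that of the Laplacian satisfy the clamped system, and scaling by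
  l yields s = m l and t = \<nu> l.\<close>

lemma eigenvalue_mode:
  assumes l: "l > 0" and ep: "eigenpair l lam u"
  obtains s t where "s > 0" "t > 0" "even_mode s t = 0 \<or> odd_mode s t = 0" "lam * l\<^sup>2 = s\<^sup>2 + t\<^sup>2"
proof -
  obtain U where U: "open U" "Omega_cl l \<subseteq> U" and C4: "Ck 4 U u"
    using ep by (auto simp: eigenpair_def)
  have pde: "Lap (Lap u) p = - lam * Lap u p" if "p \<in> Omega l" for p
    using ep that by (auto simp: eigenpair_def)
  have u0: "u p = 0" if "p \<in> Omega_cl l - Omega l" for p
    using ep that by (auto simp: eigenpair_def)
  have uy0: "Dy u (x, -l) = 0" "Dy u (x, l) = 0" if "x \<in> {0<..<pi}" for x
    using ep that by (auto simp: eigenpair_def)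
  have uxx0: "Dx (Dx u) (0, y) = 0" "Dx (Dx u) (pi, y) = 0" if "y \<in> {-l<..<l}" for y
    using ep that by (auto simp: eigenpair_def)
  obtain x0 y0 where p0: "x0 \<in> {0<..<pi}" "y0 \<in> {-l<..<l}" "u (x0, y0) \<noteq> 0"
    using ep by (auto simp: eigenpair_def Omega_def)
  define J where "J = {-l..l}"
  have UJ: "{0..pi} \<times> J \<subseteq> U" and "convex J" and y0: "y0 \<in> J"
    using U(2) p0(2) by (auto simp: Omega_cl_def J_def)
  have UJ': "{0..pi} \<times> {-l<..<l} \<subseteq> U"
    using UJ by (auto simp: J_def)
  have C4': "Ck (Suc (Suc (Suc (Suc 0)))) U u"
    using C4 by (simp only: numeral_eq_Suc pred_numeral_simps BitM.simps)
  have CL: "Ck (Suc (Suc 0)) U (Lap u)"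
    by (rule Ck_Lap[OF U(1) C4'])
  have Cy: "Ck (Suc (Suc (Suc 0))) U (Dy u)" using C4' by simp
  have CLy: "Ck (Suc 0) U (Dy (Lap u))" using CL by simp
  have "\<exists>m. sine_coeff m u y0 \<noteq> 0"
  proof (rule ccontr)
    assume "\<nexists>m. sine_coeff m u y0 \<noteq> 0"
    then have "integral {0..pi} (\<lambda>x. u (x, y0) * sin (real m * x)) = 0" for m
      by (simp add: sine_coeff_def)
    then have "u (x0, y0) = 0"
      by (rule sine_system_complete[OF continuous_on_section[OF Ck_imp_continuous_on[OF C4] UJ y0] _ p0(1)])
    with p0(3) show False by simp
  qed
  then obtain m where m: "sine_coeff m u y0 \<noteq> 0" by blast
  have "m \<noteq> 0" using m by (cases "m = 0") (simp_all add: sine_coeff_def)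
  have sides: "u (0, y) = 0" "u (pi, y) = 0" if "y \<in> J" for y
    using that by (auto intro!: u0 simp: Omega_cl_def Omega_def J_def)
  have ends: "u (x, -l) = 0" "u (x, l) = 0" if "x \<in> {0<..<pi}" for x
    using that l by (auto intro!: u0 simp: Omega_cl_def Omega_def)
  \<comment> \<open>Along the vertical sides u = 0 makes the tangential second derivative vanish,
    and the normal one vanishes by hypothesis. This is the boundary condition for integrating the
    Laplacian by parts.\<close>
  have Lap_sides: "Lap u (0, y) = 0" "Lap u (pi, y) = 0" if y: "y \<in> {-l<..<l}" for y
  proof -
    have J: "t \<in> J" if "t \<in> {-l<..<l}" for t using that by (simp add: J_def)
    have *: "Dy u (0, t) = 0" "Dy u (pi, t) = 0" if "t \<in> {-l<..<l}" for t
      using Dy_eq_0[of "-l" l u 0 t] Dy_eq_0[of "-l" l u pi t] sides J that by blast+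
    have "Dy (Dy u) (0, y) = 0" "Dy (Dy u) (pi, y) = 0"
      using Dy_eq_0[of "-l" l "Dy u" 0 y] Dy_eq_0[of "-l" l "Dy u" pi y] * y by blast+
    with uxx0[OF y] show "Lap u (0, y) = 0" "Lap u (pi, y) = 0"
      by (simp_all add: Lap_def)
  qed
  have a: "(sine_coeff m u has_real_derivative sine_coeff m (Dy u) y) (at y within {-l..l})"
    if "y \<in> {-l..l}" for y
    using sine_coeff_has_derivative[OF C4' UJ \<open>convex J\<close>] that by (simp add: J_def)
  have a': "(sine_coeff m (Dy u) has_real_derivative
      sine_coeff m (Lap u) y + (real m)\<^sup>2 * sine_coeff m u y) (at y within {-l..l})"
    if "y \<in> {-l..l}" for y
  proof -
    have y: "y \<in> J" using that by (simp add: J_def)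
    show ?thesis
      using sine_coeff_has_derivative[OF Cy UJ \<open>convex J\<close> y, of m]
        sine_coeff_Lap[OF C4' UJ y sides[OF y], of m] by (simp add: J_def)
  qed
  have b: "(sine_coeff m (Lap u) has_real_derivative sine_coeff m (Dy (Lap u)) y)
      (at y within {-l..l})" if "y \<in> {-l..l}" for y
    using sine_coeff_has_derivative[OF CL UJ \<open>convex J\<close>] that by (simp add: J_def)
  \<comment> \<open>Only interior heights are used, since the equation and \<open>Lap_sides\<close>
    are available there; continuity at the ends is supplied by \<open>cont\<close>.\<close>
  have b': "(sine_coeff m (Dy (Lap u)) has_real_derivative
      ((real m)\<^sup>2 - lam) * sine_coeff m (Lap u) y) (at y)" if y: "y \<in> {-l<..<l}" for y
  proof -
    have "sine_coeff m (Lap (Lap u)) y = - lam * sine_coeff m (Lap u) y"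
      using y by (intro sine_coeff_scale pde) (simp add: Omega_def)
    moreover have "(sine_coeff m (Dy (Lap u)) has_real_derivative sine_coeff m (Dy (Dy (Lap u))) y) (at y)"
      using sine_coeff_has_derivative[OF CLy UJ' _ y, of m] at_within_open[OF y] by simp
    moreover have "sine_coeff m (Dy (Dy (Lap u))) y
        = sine_coeff m (Lap (Lap u)) y + (real m)\<^sup>2 * sine_coeff m (Lap u) y"
      using sine_coeff_Lap[OF CL UJ' y Lap_sides[OF y], of m] by simp
    ultimately show ?thesis by (simp add: left_diff_distrib)
  qed
  have cont: "continuous_on {-l..l} (sine_coeff m (Dy (Lap u)))"
    using DERIV_continuous_on[OF sine_coeff_has_derivative[OF CLy UJ \<open>convex J\<close>]]
    by (simp add: J_def)
  have bc: "sine_coeff m u (-l) = 0" "sine_coeff m u l = 0"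
      "sine_coeff m (Dy u) (-l) = 0" "sine_coeff m (Dy u) l = 0"
    using sine_coeff_eq_0[of u "-l" m] sine_coeff_eq_0[of u l m] ends
      sine_coeff_eq_0[of "Dy u" "-l" m] sine_coeff_eq_0[of "Dy u" l m] uy0 by blast+
  have "real m > 0" using \<open>m \<noteq> 0\<close> by simp
  obtain \<nu> where \<nu>: "\<nu> > 0" "lam = (real m)\<^sup>2 + \<nu>\<^sup>2"
    and mode: "real m * sinh (real m * l) * cos (\<nu> * l) + \<nu> * cosh (real m * l) * sin (\<nu> * l) = 0 \<or>
     real m * cosh (real m * l) * sin (\<nu> * l) - \<nu> * sinh (real m * l) * cos (\<nu> * l) = 0"
    by (rule buckling_mode_condition[OF l \<open>real m > 0\<close> a a' b b' cont bc y0[unfolded J_def] m])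
  have "even_mode (m * l) (\<nu> * l) =
      l * (real m * sinh (real m * l) * cos (\<nu> * l) + \<nu> * cosh (real m * l) * sin (\<nu> * l))"
    "odd_mode (m * l) (\<nu> * l) =
      l * (real m * cosh (real m * l) * sin (\<nu> * l) - \<nu> * sinh (real m * l) * cos (\<nu> * l))"
    by (simp_all add: even_mode_def odd_mode_def algebra_simps)
  then have "even_mode (m * l) (\<nu> * l) = 0 \<or> odd_mode (m * l) (\<nu> * l) = 0"
    using mode by auto
  moreover have "lam * l\<^sup>2 = (m * l)\<^sup>2 + (\<nu> * l)\<^sup>2"
    by (simp add: \<nu>(2) power_mult_distrib algebra_simps)
  ultimately show thesis
    using that[of "m * l" "\<nu> * l"] l \<nu>(1) \<open>real m > 0\<close> by simp
qed

theorem theorem5p4: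
  shows "\<exists>ell :: nat \<Rightarrow> real. (\<forall>k. ell k > 0) \<and> ell \<longlonglongrightarrow> 0 \<and>
           (\<forall>k\<ge>1. \<exists>u. eigenpair (ell k) (lambda1 (ell k)) u \<and>
                        finite (nodal_domains (ell k) u) \<and> card (nodal_domains (ell k) u) = k)"
proof -
  obtain s t where s: "s > 0" and t: "pi / 2 < t" "t < pi" "even_mode s t = 0"
    and min: "\<And>s' t'. s' > 0 \<Longrightarrow> t' > 0 \<Longrightarrow> even_mode s' t' = 0 \<or> odd_mode s' t' = 0 \<Longrightarrow>
       s\<^sup>2 + t\<^sup>2 \<le> s'\<^sup>2 + t'\<^sup>2"
    by (rule optimal_mode) blast
  \<comment> \<open>The length s/k makes the integer frequency k hit the optimal s = k *
    \<open>ell k\<close>. The value 1 replaces the divisor at k = 0 to keep \<open>ell 0\<close>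
    positive.\<close>
  define ell where "ell = (\<lambda>k :: nat. s / (if k = 0 then 1 else real k))"
  have pos: "ell k > 0" for k
    using s by (simp add: ell_def)
  have "(\<lambda>k :: nat. s / real k) \<longlonglongrightarrow> 0"
    by (rule lim_const_over_n)
  then have "ell \<longlonglongrightarrow> 0"
    by (rule Lim_transform_eventually)
      (auto simp: ell_def eventually_sequentially intro!: exI[of _ 1])
  moreover have "\<exists>u. eigenpair (ell k) (lambda1 (ell k)) u \<and>
      finite (nodal_domains (ell k) u) \<and> card (nodal_domains (ell k) u) = k" if k: "k \<ge> 1" for k
  proof -
    define l where "l = ell k"
    have l: "l > 0" using pos by (simp add: l_def)
    have kl: "real k * l = s" using k by (simp add: l_def ell_def)
    define u where "u = (\<lambda>(x, y). sin (real k * x) * profile l s t y)"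
    have ep: "eigenpair l ((s\<^sup>2 + t\<^sup>2) / l\<^sup>2) u"
      unfolding u_def by (rule eigenpair_profile[OF l k kl t])
    have "lambda1 l = (s\<^sup>2 + t\<^sup>2) / l\<^sup>2"
      unfolding lambda1_def
    proof (rule cInf_eq_minimum)
      show "(s\<^sup>2 + t\<^sup>2) / l\<^sup>2 \<in> {lam. \<exists>u. eigenpair l lam u}"
        using ep by blast
      fix lam assume "lam \<in> {lam. \<exists>u. eigenpair l lam u}"
      then obtain v where "eigenpair l lam v" by blast
      then obtain s' t' where "s' > 0" "t' > 0" "even_mode s' t' = 0 \<or> odd_mode s' t' = 0"
        "lam * l\<^sup>2 = s'\<^sup>2 + t'\<^sup>2"
        using eigenvalue_mode[OF l] by blast
      then have "s\<^sup>2 + t\<^sup>2 \<le> lam * l\<^sup>2" using min by simp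
      then show "(s\<^sup>2 + t\<^sup>2) / l\<^sup>2 \<le> lam" using l by (simp add: field_simps)
    qed
    with ep have "eigenpair l (lambda1 l) u" by simp
    moreover have "profile l s t y \<noteq> 0" if "y \<in> {-l<..<l}" for y
      using profile_neg[OF l s t that] by simp
    from nodal_domains_sine_product[OF l k this]
    have "finite (nodal_domains l u)" "card (nodal_domains l u) = k"
      by (simp_all add: u_def)
    ultimately show ?thesis
      unfolding l_def by (intro exI conjI)
  qed
  ultimately show ?thesis using pos by blast
qed

end
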